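(* Let $s\ge2$, $h$, $t$ be positive integers with $t\mid h$, and let $q=2^h$. Assume that $\mathbb{F}_q$ is the splitting field of $g(x)=x^{2^s+1}+\sum_{i=1}^{2^{s-1}}a_ix^{2^s+1-i}+c\in\mathbb{F}_{2^t}[x]$ with $c\neq0$ and $a_i\ne0$ for $1\le i\le2^{s-1}$, that $\alpha_1,\dots,\alpha_{2^s+1}$ are all the roots of $g(x)$ and are pairwise distinct, and let $v_i=\big(\alpha_i^{2^{s-1}}+\sum_{j=1}^{2^{s-2}}a_{2j}^{2^{h-1}}\alpha_i^{2^{s-1}-j}\big)^{-1}$ for $1\le i\le2^s+1$. Let $\boldsymbol{\alpha}=(\alpha_1,\dots,\alpha_{2^s+1})$ and $\boldsymbol{v}=(v_1,\dots,v_{2^s+1})$. Let $\eta_{2^{s-1}+1}\in\mathbb{F}_q^*$ and $\eta_i=\eta_{2^{s-1}+1}a_{2^{s-1}-i+1}$ for $1\le i\le2^{s-1}$. Set $$\mathcal{S}_2=\Big\{\sum_{i=0}^{2^{s-1}-1}f_ix^i+f_0\,\eta_{2^{s-1}+1}\Big(\sum_{j=1}^{2^{s-1}}a_jx^{2^s-j}+x^{2^s}\Big): f_i\in\mathbb{F}_q\text{ for }0\le i\le2^{s-1}-1\Big\}.$$ Then $\mathcal{C}_2=ev_{\boldsymbol{\alpha},\boldsymbol{v}}(\mathcal{S}_2)$ is a $[2^s+1,\,2^{s-1}]$ self-orthogonal TGRS code over $\mathbb{F}_q$.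
   Context: For $\boldsymbol{\alpha}\in\mathbb{F}^n$ with distinct entries and $\boldsymbol{v}\in(\mathbb{F}^* )^n$ ($\mathbb{F}$ a finite field), $ev_{\boldsymbol{\alpha},\boldsymbol{v}}(f)=(v_1f(\alpha_1),\dots,v_nf(\alpha_n))$ for $f\in\mathbb{F}[x]$. For a $k\times(n-k)$ matrix $(\eta_{ij})$ over $\mathbb{F}$, the twisted generalized Reed-Solomon (TGRS) code is the image under $ev_{\boldsymbol{\alpha},\boldsymbol{v}}$ of $\{\sum_{i=0}^{k-1}f_ix^i+\sum_{i=0}^{k-1}f_i\sum_{j=1}^{n-k}\eta_{i+1,j}x^{k-1+j}:f_i\in\mathbb{F}\}$. A linear code is $[n,k]$ if it has length $n$ and dimension $k$. It is self-orthogonal if $\mathcal{C}\subseteq\mathcal{C}^\perp$ for the Euclidean inner product. *)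

theory Defs
  imports "HOL-Analysis.Analysis" "HOL-Computational_Algebra.Polynomial"
begin

definition is_subfield :: "'a::field set \<Rightarrow> bool" where
  "is_subfield K \<longleftrightarrow> 0 \<in> K \<and> 1 \<in> K \<and>
     (\<forall>x\<in>K. \<forall>y\<in>K. x + y \<in> K \<and> x * y \<in> K) \<and>
     (\<forall>x\<in>K. - x \<in> K \<and> inverse x \<in> K)"

definition poly_over :: "'a::field set \<Rightarrow> 'a poly \<Rightarrow> bool" where
  "poly_over K p \<longleftrightarrow> (\<forall>i. coeff p i \<in> K)"

text \<open>The whole field \<^typ>\<open>'a\<close> is the splitting field of \<open>p\<close> over its subfield \<open>K\<close>:
  \<open>p\<close> splits into linear factors over \<^typ>\<open>'a\<close>, and \<^typ>\<open>'a\<close> is generated over \<open>K\<close> by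
  the roots of \<open>p\<close>.\<close>

definition is_splitting_field_over :: "'a::field set \<Rightarrow> 'a poly \<Rightarrow> bool" where
  "is_splitting_field_over K p \<longleftrightarrow> is_subfield K \<and> poly_over K p \<and>
     (\<exists>rs. p = smult (lead_coeff p) (\<Prod>r\<leftarrow>rs. [:- r, 1:])) \<and>
     (\<forall>L. is_subfield L \<and> K \<subseteq> L \<and> {x. poly p x = 0} \<subseteq> L \<longrightarrow> L = UNIV)"

text \<open>Vectors of length \<open>n\<close> are indexed by a finite type \<^typ>\<open>'n\<close> with \<open>CARD('n) = n\<close>.\<close>

definition linear_code :: "nat \<Rightarrow> nat \<Rightarrow> ('a::field ^ 'n) set \<Rightarrow> bool" where
  "linear_code n k C \<longleftrightarrow> CARD('n) = n \<and> vec.subspace C \<and> vec.dim C = k"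

definition dual_code :: "('a::field ^ 'n) set \<Rightarrow> ('a ^ 'n) set" where
  "dual_code C = {x. \<forall>y\<in>C. (\<Sum>i\<in>UNIV. x $ i * y $ i) = 0}"

definition self_orthogonal :: "('a::field ^ 'n) set \<Rightarrow> bool" where
  "self_orthogonal C \<longleftrightarrow> C \<subseteq> dual_code C"

definition ev :: "'a::field ^ 'n \<Rightarrow> 'a ^ 'n \<Rightarrow> 'a poly \<Rightarrow> 'a ^ 'n" where
  "ev \<alpha> v f = (\<chi> i. v $ i * poly f (\<alpha> $ i))"

text \<open>The \<open>k \<times> (n - k)\<close> matrix \<open>\<eta>\<close> is a function of which only the entries \<open>\<eta> i j\<close>
  with \<open>1 \<le> i \<le> k\<close> and \<open>1 \<le> j \<le> n - k\<close> are used.\<close>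

definition tgrs_polys :: "nat \<Rightarrow> nat \<Rightarrow> (nat \<Rightarrow> nat \<Rightarrow> 'a::field) \<Rightarrow> 'a poly set" where
  "tgrs_polys n k \<eta> =
     {(\<Sum>i<k. monom (f i) i) +
      (\<Sum>i<k. smult (f i) (\<Sum>j=1..n-k. monom (\<eta> (i + 1) j) (k - 1 + j))) | f. True}"

definition is_TGRS_code ::
    "'a::field ^ 'n \<Rightarrow> 'a ^ 'n \<Rightarrow> nat \<Rightarrow> ('a ^ 'n) set \<Rightarrow> bool" where
  "is_TGRS_code \<alpha> v k C \<longleftrightarrow> inj (($) \<alpha>) \<and> (\<forall>i. v $ i \<noteq> 0) \<and> 1 \<le> k \<and> k \<le> CARD('n) \<and>
     (\<exists>\<eta>. C = ev \<alpha> v ` tgrs_polys CARD('n) k \<eta>)"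

end

theory Submission
  imports Defs
begin

text \<open>
  Put \<open>m = 2^(s-1)\<close>. In characteristic two the square of
  \<open>x^m + \<Sum>j. a\<^sub>2\<^sub>j^(q/2) x^(m-j)\<close> is the derivative \<open>g'\<close>, so \<open>v\<^sub>i\<^sup>2 = 1 / g'(\<alpha>\<^sub>i)\<close>, and by
  Lagrange interpolation \<open>\<Sum>i. v\<^sub>i\<^sup>2 p(\<alpha>\<^sub>i) = 0\<close> for every \<open>p\<close> of degree less than \<open>2 m\<close>.
  Let \<open>G = x G\<^sub>1\<close> be the polynomial with \<open>g = x G + c\<close>. At the roots of \<open>g\<close> one has \<open>x G = -c\<close> and
  \<open>G\<^sup>2 = -c G\<^sub>1\<close>, and the cross term \<open>2 f\<^sub>0 f\<^sub>0' \<eta> G\<close> vanishes, so the product of two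
  elements of \<open>\<S>\<^sub>2\<close> agrees on the roots with a polynomial of degree less than \<open>2 m\<close>.
\<close>

section \<open>Finite fields of characteristic two\<close>

text \<open>For x \<noteq> 0, multiplication by x permutes the nonzero elements, so their product is
  unchanged when every factor is multiplied by x. Cancelling the product leaves x^(q-1) = 1.\<close>

lemma finite_field_power_card:
  fixes x :: "'a :: {field, finite}"
  shows "x ^ CARD('a) = x"
proof (cases "x = 0")
  case True
  then show ?thesis by (simp add: zero_power)
next
  case False
  let ?U = "UNIV - {0 :: 'a}"
  have "bij_betw ((*) x) ?U ?U"
    by (rule bij_betwI[of _ _ _ "(*) (inverse x)"]) (use False in \<open>auto simp: field_simps\<close>)
  then have "(\<Prod>y\<in>?U. y) = (\<Prod>y\<in>?U. x * y)"
    by (rule prod.reindex_bij_betw[symmetric])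
  also have "\<dots> = x ^ card ?U * (\<Prod>y\<in>?U. y)"
    by (simp add: prod.distrib)
  finally have 1: "x ^ card ?U = 1"
    by simp
  have 2: "CARD('a) = Suc (card ?U)"
    by (simp add: card_Diff_singleton Suc_diff_1[OF finite_UNIV_card_ge_0])
  show ?thesis
    by (subst 2) (simp only: power_Suc 1 mult_1_right)
qed

text \<open>Translation by 1 permutes the field, so adding 1 to every element leaves the sum of all
  elements unchanged. Hence 2^h = 0 in the field, and a field has no nilpotents other than
  0.\<close>

lemma two_eq_0_if_card_eq_power_2:
  assumes "CARD('a :: {field, finite}) = 2 ^ h"
  shows "(2 :: 'a) = 0"
proof -
  have "(\<Sum>y\<in>UNIV. y) = (\<Sum>y\<in>(UNIV :: 'a set). 1 + y)"
    by (rule sum.reindex_bij_betw[symmetric])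
       (rule bij_betwI[of _ _ _ "\<lambda>y. y - 1"], auto)
  also have "\<dots> = of_nat CARD('a) + (\<Sum>y\<in>UNIV. y)"
    by (simp add: sum.distrib)
  finally have "(2 :: 'a) ^ h = 0"
    unfolding assms by simp
  then show ?thesis by simp
qed

lemma sum_power2_char_2:
  fixes f :: "'b \<Rightarrow> 'a :: comm_ring_1"
  assumes "(2 :: 'a) = 0"
  shows "(\<Sum>i\<in>A. f i)\<^sup>2 = (\<Sum>i\<in>A. (f i)\<^sup>2)"
  by (induction A rule: infinite_finite_induct) (simp_all add: power2_sum assms)

section \<open>Lagrange interpolation and derivatives at the roots\<close>

lemma degree_prod_linear:
  fixes A :: "'a :: field set"
  shows "degree (\<Prod>y\<in>A. [:- y, 1:]) = card A"
  by (subst degree_prod_eq_sum_degree) auto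

lemma lead_coeff_prod_linear:
  fixes A :: "'a :: field set"
  shows "coeff (\<Prod>y\<in>A. [:- y, 1:]) (card A) = 1"
  using lead_coeff_prod[of "\<lambda>y. [:- y, 1:]" A] by (simp add: degree_prod_linear)

text \<open>Lagrange interpolation on A recovers \<open>p\<close>. Each basis polynomial
  \<open>L x\<close> is monic of degree card A - 1, so comparing the coefficients at that degree
  gives the sum of the weights \<open>w x\<close>.\<close>

lemma sum_over_prod_diff:
  fixes A :: "'a :: field set"
  assumes "finite A" and "degree p < card A"
  shows "(\<Sum>x\<in>A. poly p x / (\<Prod>y\<in>A - {x}. x - y)) = coeff p (card A - 1)"
proof -
  define L where "L x = (\<Prod>y\<in>A - {x}. [:- y, 1:])" for x
  define w where "w x = poly p x / (\<Prod>y\<in>A - {x}. x - y)" for x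
  define P where "P = (\<Sum>x\<in>A. smult (w x) (L x))"
  have degL: "degree (L x) = card A - 1" and coeffL: "coeff (L x) (card A - 1) = 1" if "x \<in> A" for x
    using that assms(1) degree_prod_linear[of "A - {x}"] lead_coeff_prod_linear[of "A - {x}"]
    by (simp_all add: L_def card_Diff_singleton)
  have "degree P \<le> card A - 1"
    unfolding P_def
    by (rule degree_sum_le) (use assms(1) degL in \<open>auto intro: order.trans[OF degree_smult_le]\<close>)
  then have "degree P < card A"
    using assms(2) by linarith
  moreover have "poly p z = poly P z" if "z \<in> A" for z
  proof -
    have "poly (L x) z = 0" if "x \<in> A - {z}" for x
      using \<open>z \<in> A\<close> that assms(1) by (auto simp: L_def poly_prod)
    then have "poly P z = w z * poly (L z) z"
      unfolding P_def poly_sum poly_smult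
      using \<open>z \<in> A\<close> assms(1) by (subst sum.remove[of A z]) auto
    also have "\<dots> = poly p z"
      using assms(1) by (simp add: w_def L_def poly_prod)
    finally show ?thesis by simp
  qed
  ultimately have "p = P"
    using assms(2) by (intro poly_eqI_degree[of A]) auto
  then have "coeff p (card A - 1) = (\<Sum>x\<in>A. w x * coeff (L x) (card A - 1))"
    by (simp add: P_def coeff_sum)
  also have "\<dots> = (\<Sum>x\<in>A. w x)"
    using coeffL by simp
  finally show ?thesis by (simp add: w_def)
qed

text \<open>Being monic with as many distinct roots as its degree, \<open>g\<close> is the product
  of the linear factors over A. In the product rule, only the summand that omits the factor at x
  survives at x.\<close>

lemma poly_pderiv_eq_prod_diff_roots:
  fixes g :: "'a :: field poly"
  assumes "lead_coeff g = 1" and "degree g = card A"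
    and "\<And>x. x \<in> A \<Longrightarrow> poly g x = 0" and "finite A" and "x \<in> A"
  shows "poly (pderiv g) x = (\<Prod>y\<in>A - {x}. x - y)"
proof -
  have "g = (\<Prod>y\<in>A. [:- y, 1:])"
    by (rule poly_eqI_degree_lead_coeff[of _ "card A" _ A])
       (use assms in \<open>auto simp: lead_coeff_prod_linear degree_prod_linear poly_prod\<close>)
  then have "poly (pderiv g) x = (\<Sum>z\<in>A. \<Prod>y\<in>A - {z}. x - y)"
    by (simp add: pderiv_prod poly_sum poly_prod pderiv_pCons)
  also have "\<dots> = (\<Prod>y\<in>A - {x}. x - y)"
    using assms(4,5) by (subst sum.remove[of A x]) (auto intro!: sum.neutral prod_zero)
  finally show ?thesis .
qed

text \<open>The values 1 / g'(x) are the Lagrange weights of A, so the sum is a coefficient of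
  \<open>p\<close> beyond its degree. This is the source of the orthogonality relations.\<close>

lemma sum_over_pderiv_eq_0:
  fixes g :: "'a :: field poly"
  assumes "lead_coeff g = 1" and "degree g = card A"
    and "\<And>x. x \<in> A \<Longrightarrow> poly g x = 0" and "finite A" and "degree p < card A - 1"
  shows "(\<Sum>x\<in>A. poly p x / poly (pderiv g) x) = 0"
proof -
  have "(\<Sum>x\<in>A. poly p x / poly (pderiv g) x) = (\<Sum>x\<in>A. poly p x / (\<Prod>y\<in>A - {x}. x - y))"
    by (rule sum.cong) (simp_all add: poly_pderiv_eq_prod_diff_roots[OF assms(1-4)])
  also have "\<dots> = coeff p (card A - 1)"
    using assms(4,5) by (intro sum_over_prod_diff) auto
  finally show ?thesis
    using assms(5) by (simp add: coeff_eq_0)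
qed

section \<open>Subspaces spanned by an indexed family\<close>

text \<open>The hypothesis is independence of an indexed family, whereas span and dimension speak of
  sets. Injectivity of \<open>B\<close> on the indices lets coefficients pass from one setting to
  the other.\<close>

lemma subspace_dim_parametrized:
  fixes B :: "nat \<Rightarrow> 'a :: field ^ 'n"
  assumes "\<And>f i. (\<Sum>i<k. f i *s B i) = 0 \<Longrightarrow> i < k \<Longrightarrow> f i = 0"
  shows "vec.subspace (range (\<lambda>f. \<Sum>i<k. f i *s B i))"
    and "vec.dim (range (\<lambda>f. \<Sum>i<k. f i *s B i)) = k"
proof -
  let ?V = "range (\<lambda>f. \<Sum>i<k. f i *s B i)"
  have inj: "inj_on B {..<k}"
  proof (rule inj_onI, rule ccontr)
    fix i j assume ij: "i \<in> {..<k}" "j \<in> {..<k}" "B i = B j" "i \<noteq> j"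
    \<comment> \<open>A repeated vector would give the nontrivial relation B i - B j = 0.\<close>
    define f :: "nat \<Rightarrow> 'a" where "f = (\<lambda>l. if l = i then 1 else if l = j then - 1 else 0)"
    have "(\<Sum>l<k. f l *s B l) = (\<Sum>l\<in>{i, j}. f l *s B l)"
      by (rule sum.mono_neutral_right) (use ij in \<open>auto simp: f_def\<close>)
    also have "\<dots> = 0"
      using ij by (simp add: f_def vec_eq_iff)
    finally have "f i = 0"
      using assms ij by simp
    then show False by (simp add: f_def)
  qed
  have span: "vec.span (B ` {..<k}) = ?V"
  proof -
    have "vec.span (B ` {..<k}) = range (\<lambda>u. \<Sum>i<k. u (B i) *s B i)"
      by (simp add: vec.span_finite sum.reindex[OF inj] o_def)
    also have "\<dots> = ?V"
    proof (intro equalityI subsetI)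
      fix x assume "x \<in> ?V"
      then obtain f where "x = (\<Sum>i<k. f i *s B i)" by auto
      then have "x = (\<Sum>i<k. (f \<circ> inv_into {..<k} B) (B i) *s B i)"
        by (simp add: inv_into_f_f[OF inj])
      then show "x \<in> range (\<lambda>u. \<Sum>i<k. u (B i) *s B i)" by blast
    qed auto
    finally show ?thesis .
  qed
  have "vec.independent (B ` {..<k})"
  proof (rule vec.independent_if_scalars_zero)
    fix f x assume "(\<Sum>x\<in>B ` {..<k}. f x *s x) = 0" "x \<in> B ` {..<k}"
    then show "f x = 0"
      using assms[of "f \<circ> B"] by (auto simp: sum.reindex[OF inj])
  qed simp
  then show "vec.dim ?V = k"
    using vec.dim_span_eq_card_independent card_image[OF inj] unfolding span[symmetric] by fastforce
  show "vec.subspace ?V"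
    by (simp flip: span)
qed

theorem theorem22:
  fixes s h t :: nat
    and a \<eta> :: "nat \<Rightarrow> 'a :: {field, finite}"
    and c :: 'a
    and F :: "'a set"
    and g :: "'a poly"
    and \<alpha> v :: "'a ^ 'n"
    and S2 :: "'a poly set"
  assumes "s \<ge> 2" and "h \<ge> 1" and "t \<ge> 1" and "t dvd h"
    and "CARD('a) = 2 ^ h"
    and "is_subfield F" and "card F = 2 ^ t"
    and "g = monom 1 (2 ^ s + 1) + (\<Sum>i=1..2 ^ (s - 1). monom (a i) (2 ^ s + 1 - i)) + [:c:]"
    and "poly_over F g"
    and "c \<noteq> 0" and "\<forall>i\<in>{1..2 ^ (s - 1)}. a i \<noteq> 0"
    and "is_splitting_field_over F g"
    and "CARD('n) = 2 ^ s + 1"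
    and "inj (($) \<alpha>)" and "range (($) \<alpha>) = {x. poly g x = 0}"
    and "\<forall>i. v $ i = inverse ((\<alpha> $ i) ^ (2 ^ (s - 1)) +
           (\<Sum>j=1..2 ^ (s - 2). (a (2 * j)) ^ (2 ^ (h - 1)) * (\<alpha> $ i) ^ (2 ^ (s - 1) - j)))"
    and "\<eta> (2 ^ (s - 1) + 1) \<noteq> 0"
    and "\<forall>i\<in>{1..2 ^ (s - 1)}. \<eta> i = \<eta> (2 ^ (s - 1) + 1) * a (2 ^ (s - 1) - i + 1)"
    and "S2 = {(\<Sum>i=0..2 ^ (s - 1) - 1. monom (f i) i) +
               smult (f 0 * \<eta> (2 ^ (s - 1) + 1))
                 ((\<Sum>j=1..2 ^ (s - 1). monom (a j) (2 ^ s - j)) + monom 1 (2 ^ s)) | f. True}"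
  shows "linear_code (2 ^ s + 1) (2 ^ (s - 1)) (ev \<alpha> v ` S2)
       \<and> self_orthogonal (ev \<alpha> v ` S2)
       \<and> is_TGRS_code \<alpha> v (2 ^ (s - 1)) (ev \<alpha> v ` S2)"
proof -

  \<comment> \<open>Shape of the polynomials \<open>G1\<close>, \<open>G\<close> and
    \<open>g\<close>\<close>
  define m :: nat where "m = 2 ^ (s - 1)"
  define e where "e = \<eta> (m + 1)"
  define G1 where "G1 = (\<Sum>j=1..m. monom (a j) (2 * m - 1 - j)) + monom 1 (2 * m - 1)"
  define G where "G = pCons 0 G1"
  define P where "P f = (\<Sum>i<m. monom (f i) i) + smult (f 0 * e) G" for f
  have s2: "2 ^ s = 2 * m" and s1: "2 ^ (s - 2) = m div 2" and m2: "m \<ge> 2" and "even m"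
  proof -
    obtain r where "s = Suc (Suc r)"
      using assms(1) by (metis Suc_diff_le Suc_1 le_add_diff_inverse plus_1_eq_Suc add_2_eq_Suc)
    then show "2 ^ s = 2 * m" "2 ^ (s - 2) = m div 2" "m \<ge> 2" "even m"
      by (simp_all add: m_def)
  qed
  have two: "(2 :: 'a) = 0"
    using two_eq_0_if_card_eq_power_2 assms(5) .
  have cardn: "CARD('n) = 2 * m + 1"
    using assms(13) s2 by simp
  have inj: "inj (($) \<alpha>)" using assms(14) .

  have coeffG1: "coeff G1 l = 0" if "l \<ge> 2 * m" for l
    using that m2 by (auto simp: G1_def coeff_sum intro!: sum.neutral)
  \<comment> \<open>The lowest exponent listed in \<open>G1\<close> is m - 1, at j = m. So
    \<open>G\<close> has no term below x^m, and the twist leaves the first m coefficients of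
    \<open>P f\<close> untouched.\<close>
  have coeffG1_low: "coeff G1 l = 0" if "Suc l < m" for l
    using that m2 by (auto simp: G1_def coeff_sum intro!: sum.neutral)
  have degG1: "degree G1 \<le> 2 * m - 1"
    using m2 by (intro degree_le allI impI coeffG1) linarith
  have G: "G = (\<Sum>j=1..m. monom (a j) (2 * m - j)) + monom 1 (2 * m)"
  proof -
    have "(\<Sum>j=1..m. monom (a j) (2 * m - j)) = (\<Sum>j=1..m. pCons 0 (monom (a j) (2 * m - 1 - j)))"
      using m2 by (intro sum.cong) (auto simp: Suc_diff_Suc simp flip: monom_Suc)
    also have "\<dots> = pCons 0 (\<Sum>j=1..m. monom (a j) (2 * m - 1 - j))"
      by (rule poly_eqI) (auto simp: coeff_sum coeff_pCons split: nat.splits)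
    moreover have "monom (1 :: 'a) (2 * m) = pCons 0 (monom 1 (2 * m - 1))"
      using m2 by (simp flip: monom_Suc)
    ultimately show ?thesis
      by (simp add: G_def G1_def)
  qed
  have g_G: "g = pCons c G"
  proof -
    have "(\<Sum>i=1..m. monom (a i) (2 * m + 1 - i)) = (\<Sum>i=1..m. pCons 0 (monom (a i) (2 * m - i)))"
      by (intro sum.cong) (auto simp: Suc_diff_le simp flip: monom_Suc)
    also have "\<dots> = pCons 0 (\<Sum>i=1..m. monom (a i) (2 * m - i))"
      by (rule poly_eqI) (auto simp: coeff_sum coeff_pCons split: nat.splits)
    finally show ?thesis
      unfolding assms(8) s2 m_def[symmetric] by (simp add: G monom_Suc)
  qed
  have coeffG: "coeff G (2 * m) = 1"
    using m2 by (auto simp: G coeff_sum intro!: sum.neutral)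
  have degG: "degree G \<le> 2 * m"
    using degree_pCons_le[of 0 G1] degG1 m2 by (simp add: G_def)
  have degg: "degree g = 2 * m + 1"
  proof (rule antisym)
    show "degree g \<le> 2 * m + 1"
      using degree_pCons_le[of c G] degG by (simp add: g_G)
    show "2 * m + 1 \<le> degree g"
      using coeffG by (intro le_degree) (simp add: g_G)
  qed
  have lcg: "lead_coeff g = 1"
    by (simp add: degg) (simp add: g_G coeffG)
  have root: "poly g (\<alpha> $ i) = 0" for i
    using assms(15) by auto

  \<comment> \<open>Roots of \<open>g\<close> and the multipliers \<open>v\<close>\<close>
  define A where "A = range (($) \<alpha>)"
  have A: "finite A" "card A = 2 * m + 1" "\<And>x. x \<in> A \<Longrightarrow> poly g x = 0"
    using card_image[OF inj] root cardn by (auto simp: A_def)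

  have pderiv_g: "poly (pderiv g) x =
      (x ^ m + (\<Sum>j=1..m div 2. a (2 * j) ^ 2 ^ (h - 1) * x ^ (m - j)))\<^sup>2" for x
  proof -
    have sqrt: "(b ^ 2 ^ (h - 1))\<^sup>2 = b" for b :: 'a
    proof -
      have "(b ^ 2 ^ (h - 1))\<^sup>2 = b ^ (2 ^ Suc (h - 1))"
        by (simp add: mult.commute flip: power_mult)
      then show ?thesis
        using finite_field_power_card[of b] assms(2,5) by simp
    qed
    have ofnat: "(of_nat n :: 'a) = (if odd n then 1 else 0)" for n
      by (induction n) (auto simp: two)
    have "pderiv g = monom (of_nat (2 * m + 1)) (2 * m) +
        (\<Sum>i=1..m. monom (of_nat (2 * m + 1 - i) * a i) (2 * m - i))"
      unfolding assms(8) s2 m_def[symmetric] pderiv_add pderiv_monom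
        higher_pderiv_sum[of 1, simplified]
      by (simp add: pderiv_pCons del: of_nat_add of_nat_Suc)
    then have "poly (pderiv g) x = x ^ (2 * m) +
        (\<Sum>i=1..m. of_nat (2 * m + 1 - i) * a i * x ^ (2 * m - i))"
      unfolding ofnat by (simp add: poly_monom poly_sum)
    \<comment> \<open>The factor 2m + 1 - i is 1 for even i and 0 for odd i. The surviving exponents
      2m - i are even, which makes each remaining term a square.\<close>
    also have "(\<Sum>i=1..m. of_nat (2 * m + 1 - i) * a i * x ^ (2 * m - i)) =
        (\<Sum>i\<in>{i\<in>{1..m}. even i}. a i * x ^ (2 * m - i))"
      by (subst sum.inter_filter) (auto intro!: sum.cong simp del: of_nat_diff simp: ofnat)
    also have "\<dots> = (\<Sum>j=1..m div 2. a (2 * j) * x ^ (2 * m - 2 * j))"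
    proof (rule sum.reindex_bij_witness[of _ "\<lambda>j. 2 * j" "\<lambda>i. i div 2"])
    qed (use \<open>even m\<close> in \<open>auto elim!: evenE\<close>)
    also have "\<dots> = (\<Sum>j=1..m div 2. (a (2 * j) ^ 2 ^ (h - 1) * x ^ (m - j))\<^sup>2)"
      by (intro sum.cong refl)
         (simp only: power_mult_distrib sqrt diff_mult_distrib2[symmetric] power_even_eq)
    also have "x ^ (2 * m) = (x ^ m)\<^sup>2"
      by (rule power_even_eq)
    finally show ?thesis
      by (simp add: power2_sum two sum_power2_char_2)
  qed
  have v2: "(v $ i)\<^sup>2 = inverse (poly (pderiv g) (\<alpha> $ i))" for i
    using assms(16) unfolding s1 m_def[symmetric] by (simp add: pderiv_g power_inverse)
  \<comment> \<open>As \<open>inverse 0 = 0\<close>, the definition of \<open>v\<close> does not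
    exclude zero entries by itself. The roots being distinct, g' has no zero among them.\<close>
  have v_nz: "v $ i \<noteq> 0" for i
  proof -
    have "poly (pderiv g) (\<alpha> $ i) = (\<Prod>y\<in>A - {\<alpha> $ i}. \<alpha> $ i - y)"
      using poly_pderiv_eq_prod_diff_roots[OF lcg _ A(3,1)] degg A(2) by (simp add: A_def)
    also have "\<dots> \<noteq> 0"
      using A by simp
    finally show ?thesis
      using v2[of i] by auto
  qed
  have sum_v2: "(\<Sum>i\<in>UNIV. (v $ i)\<^sup>2 * poly p (\<alpha> $ i)) = 0" if "degree p < 2 * m" for p
  proof -
    have "(\<Sum>x\<in>A. poly p x / poly (pderiv g) x) = 0"
      using sum_over_pderiv_eq_0[OF lcg _ A(3,1)] degg A(2) that by simp
    then show ?thesis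
      by (simp add: A_def sum.reindex[OF inj] v2 divide_inverse mult.commute)
  qed

  have deg_low: "degree (\<Sum>i<m. monom (f i) i) < m" for f :: "nat \<Rightarrow> 'a"
    using m2 by (intro degree_lessI) (auto simp: coeff_sum)
  have coeffP: "coeff (P f) i = f i" if "i < m" for f i
  proof -
    have "coeff G i = 0"
      using that by (cases i) (auto simp: G_def coeffG1_low)
    then show ?thesis
      using that by (simp add: P_def coeff_sum)
  qed
  have degP: "degree (P f) \<le> 2 * m" for f
    unfolding P_def
    by (rule degree_add_le) (use deg_low[of f] degG in \<open>auto intro: order.trans[OF degree_smult_le]\<close>)
  have S2: "S2 = range P"
  proof -
    have "{0..2 ^ (s - 1) - 1} = {..<m}"
      unfolding m_def[symmetric] using m2 by auto
    then show ?thesis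
      using assms(19) unfolding s2 m_def[symmetric] by (auto simp: P_def G e_def)
  qed

  \<comment> \<open>Self-orthogonality\<close>
  have ortho: "(\<Sum>i\<in>UNIV. ev \<alpha> v (P f) $ i * ev \<alpha> v (P f') $ i) = 0" for f f'
  proof -
    define u where "u f = (\<Sum>i<m. monom (f i) i)" for f :: "nat \<Rightarrow> 'a"
    \<comment> \<open>\<open>U f\<close> is (u f - f 0) / x. Splitting off the constant term gives G
      * u f = f 0 * G + (x G) * U f, where x G can be replaced by -c at the roots.\<close>
    define U where "U f = (\<Sum>i<m-1. monom (f (Suc i)) i)" for f :: "nat \<Rightarrow> 'a"
    have u: "u f = pCons (f 0) (U f)" for f
      using m2 by (intro poly_eqI) (auto simp: u_def U_def coeff_sum coeff_pCons split: nat.splits)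
    define W where "W = smult (f 0) (U f') + smult (f' 0) (U f)"
    \<comment> \<open>The product of \<open>P f\<close> and \<open>P f'\<close> after reduction at
      the roots: the terms linear in \<open>e\<close> become -c e W, and G^2 = (x G) G1 becomes -c
      G1.\<close>
    define H where "H = u f * u f' - smult (c * e) W - smult (c * f 0 * f' 0 * e\<^sup>2) G1"
    have degu: "degree (u f) < m" for f
      unfolding u_def by (rule deg_low)
    have degU: "degree (U f) < m" for f
      unfolding U_def using m2 by (intro degree_lessI) (auto simp: coeff_sum)
    have "degree (u f * u f') \<le> 2 * m - 1"
      using degree_mult_le[of "u f" "u f'"] degu[of f] degu[of f'] by linarith
    moreover have "degree (smult b (U f)) \<le> 2 * m - 1" for b f
      using degree_smult_le[of b "U f"] degU[of f] by linarith
    ultimately have "degree H \<le> 2 * m - 1"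
      unfolding H_def W_def smult_add_right smult_smult
      by (intro degree_diff_le degree_add_le order.trans[OF degree_smult_le degG1])
    then have "degree H < 2 * m" using m2 by linarith
    moreover have "poly (P f) x * poly (P f') x = poly H x" if "poly g x = 0" for x
    proof -
      define y where "y = poly G1 x"
      have Gx: "poly G x = x * y"
        by (simp add: G_def y_def)
      have xy: "x * (x * y) = - c"
        using that by (simp add: g_G Gx add_eq_0_iff)
      \<comment> \<open>The last summand stems from f 0 * f' 0 * e * G, which can have degree 2m and
        so escape \<open>sum_v2\<close>; it occurs twice and disappears in characteristic
        two.\<close>
      have "poly (P f) x * poly (P f') x =
          poly (u f) x * poly (u f') x + e * (x * (x * y)) * poly W x
          + f 0 * f' 0 * e\<^sup>2 * (x * (x * y)) * y + 2 * (f 0 * f' 0 * e * (x * y))"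
        unfolding P_def u_def[symmetric] W_def
        by (simp add: u Gx algebra_simps power2_eq_square)
      also have "\<dots> = poly H x"
        unfolding xy two by (simp add: H_def y_def algebra_simps)
      finally show ?thesis .
    qed
    ultimately show ?thesis
      using sum_v2[of H] root by (simp add: ev_def power2_eq_square mult_ac)
  qed

  \<comment> \<open>Dimension of the code\<close>
  define B where "B i = ev \<alpha> v (P (\<lambda>l. if l = i then 1 else 0))" for i
  have ev_P: "ev \<alpha> v (P f) = (\<Sum>i<m. f i *s B i)" for f
  proof -
    have "P f = (\<Sum>i<m. smult (f i) (P (\<lambda>l. if l = i then 1 else 0)))"
    proof (rule poly_eqI)
      fix l
      have *: "(\<Sum>j<m. coeff (monom (if j = i then 1 else 0) j) l) = (if l = i then 1 else 0 :: 'a)"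
        if "i < m" for i
        using that by (subst sum.remove[of _ i]) (auto intro!: sum.neutral)
      show "coeff (P f) l = coeff (\<Sum>i<m. smult (f i) (P (\<lambda>l. if l = i then 1 else 0))) l"
        using m2
        by (simp add: P_def coeff_sum * distrib_left sum.distrib if_distrib[of "(*) _"]
              if_distrib[of "\<lambda>x. x * _"] cong: if_cong)
    qed
    then show ?thesis
      by (simp add: B_def ev_def vec_eq_iff poly_sum sum_distrib_left mult_ac)
  qed
  have C: "ev \<alpha> v ` S2 = range (\<lambda>f. \<Sum>i<m. f i *s B i)"
    by (simp add: S2 image_image ev_P)
  have indep: "f i = 0" if "(\<Sum>i<m. f i *s B i) = 0" "i < m" for f i
  proof -
    have "ev \<alpha> v (P f) = 0"
      using that by (simp add: ev_P)
    then have "poly (P f) x = poly 0 x" if "x \<in> A" for x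
      using that v_nz by (auto simp: A_def ev_def vec_eq_iff)
    \<comment> \<open>A polynomial of degree at most 2m vanishes at all 2m + 1 points of A.\<close>
    then have "P f = 0"
      by (rule poly_eqI_degree) (use A degP[of f] in auto)
    then show ?thesis
      using coeffP[OF that(2), of f] by simp
  qed
  have "vec.subspace (ev \<alpha> v ` S2)" "vec.dim (ev \<alpha> v ` S2) = m"
    unfolding C by (rule subspace_dim_parametrized, fact indep)+
  then have "linear_code (2 ^ s + 1) m (ev \<alpha> v ` S2)"
    using assms(13) by (simp add: linear_code_def)
  moreover have "self_orthogonal (ev \<alpha> v ` S2)"
    using ortho by (auto simp: self_orthogonal_def dual_code_def S2)

  \<comment> \<open>The code as a TGRS code\<close>
  moreover have "is_TGRS_code \<alpha> v m (ev \<alpha> v ` S2)"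
  proof -
    \<comment> \<open>Only f_0 carries a twist, so every row of the twist matrix other than the
      first is zero. Its m + 1 columns reach the exponents m to 2m.\<close>
    define \<theta> where "\<theta> i j = (if i = 1 then \<eta> j else 0)" for i j :: nat
    have eG: "(\<Sum>j=1..m+1. monom (\<eta> j) (m - 1 + j)) = smult e G"
    proof -
      \<comment> \<open>The coefficients of \<open>\<eta>\<close> list those of \<open>a\<close> in
        reverse order, hence the substitution of m + 1 - j for j. The column j = m + 1 supplies the
        leading term e x^(2m).\<close>
      have "(\<Sum>j=1..m. monom (\<eta> j) (m - 1 + j)) = (\<Sum>j=1..m. monom (e * a j) (2 * m - j))"
        by (rule sum.reindex_bij_witness[of _ "\<lambda>j. m + 1 - j" "\<lambda>j. m + 1 - j"])
           (use assms(18)[folded m_def] in \<open>auto simp: e_def Suc_diff_le\<close>)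
      also have "\<dots> = smult e (\<Sum>j=1..m. monom (a j) (2 * m - j))"
        by (rule poly_eqI) (auto simp: coeff_sum sum_distrib_left intro!: sum.cong)
      finally show ?thesis
        using m2 by (simp add: G e_def smult_add_right smult_monom mult_2)
    qed
    have "(\<Sum>i<m. smult (f i) (\<Sum>j=1..m+1. monom (\<theta> (i + 1) j) (m - 1 + j))) =
        smult (f 0 * e) G" for f
      using m2 eG by (subst sum.remove[of _ 0]) (auto simp: \<theta>_def intro!: sum.neutral)
    then have "tgrs_polys CARD('n) m \<theta> = S2"
      by (auto simp: tgrs_polys_def S2 P_def cardn)
    then show ?thesis
      using inj v_nz m2 cardn by (auto simp: is_TGRS_code_def)
  qed
  ultimately show ?thesis
    by (simp add: m_def)
qed

end
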